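(* Let $T$ be a triangle with vertices $A$, $B$, and $C$, and respective opposite side lengths $\lambda_A = BC$, $\lambda_B = CA$, and $\lambda_C = AB$. Suppose that the two sides passing through $A$ (resp. $B$, $C$) are extended by a distance $x_A$ (resp. $x_B$, $x_C$). The six endpoints of these extensions lie on a common circle centered at the incenter of $T$ if and only if $x_U - x_V = \lambda_U - \lambda_V$ for all vertices $U$ and $V$ of $T$.
   Context: The triangle lies in the Euclidean plane. At each vertex $V$ of $T$, each of the two sides through $V$ is extended beyond $V$ by the distance $x_V$: extending the side $UV$ beyond $V$ by $x_V$ gives the endpoint $V + x_V\,\frac{V-U}{|V-U|}$. Doing this for the two sides at each of the three vertices gives the six endpoints. *)

theory Defs
  imports "HOL-Analysis.Analysis"
begin

definition extension_endpoint :: "real^2 \<Rightarrow> real^2 \<Rightarrow> real \<Rightarrow> real^2" where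
  "extension_endpoint U V d = V + d *\<^sub>R ((V - U) /\<^sub>R norm (V - U))"

text \<open>A circle is tangent to the side \<open>PQ\<close> if it meets the line through \<open>P\<close> and \<open>Q\<close> in exactly
  one point, and this point lies on the side itself. The last requirement is what
  distinguishes the incircle of a triangle from its excircles.\<close>

definition tangent_to_side :: "real^2 \<Rightarrow> real \<Rightarrow> real^2 \<Rightarrow> real^2 \<Rightarrow> bool" where
  "tangent_to_side I r P Q \<longleftrightarrow>
     (\<exists>p\<in>closed_segment P Q. sphere I r \<inter> affine hull {P, Q} = {p})"

definition inscribed_circle :: "real^2 \<Rightarrow> real \<Rightarrow> real^2 \<Rightarrow> real^2 \<Rightarrow> real^2 \<Rightarrow> bool" where
  "inscribed_circle I r A B C \<longleftrightarrow>
     r > 0 \<and> tangent_to_side I r B C \<and> tangent_to_side I r C A \<and> tangent_to_side I r A B"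

text \<open>Meaningful for non-collinear \<open>A\<close>, \<open>B\<close>, \<open>C\<close>, where the inscribed circle exists and is unique.\<close>

definition incenter :: "real^2 \<Rightarrow> real^2 \<Rightarrow> real^2 \<Rightarrow> real^2" where
  "incenter A B C = (THE I. \<exists>r. inscribed_circle I r A B C)"

end

theory Submission
  imports Defs
begin

text \<open>Write \<open>t\<^sub>V\<close> for the length of the tangents from the vertex \<open>V\<close> to the incircle, which has
  radius \<open>\<rho>\<close>. The contact point on a side through \<open>V\<close> is the foot of the perpendicular from
  the incenter \<open>I\<close>, so an endpoint \<open>E\<close> obtained by extending that side beyond \<open>V\<close> by \<open>x\<^sub>V\<close>
  satisfies \<open>IE\<^sup>2 = \<rho>\<^sup>2 + (t\<^sub>V + x\<^sub>V)\<^sup>2\<close>. Since \<open>t\<^sub>V + x\<^sub>V\<close> is positive, the six distances agree iff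
  \<open>t\<^sub>V + x\<^sub>V\<close> is independent of \<open>V\<close>; and \<open>t\<^sub>V\<close> is the semiperimeter minus \<open>\<lambda>\<^sub>V\<close>.\<close>

section \<open>Tangency to a side and perpendicular feet\<close>

lemma inner_diff_self_eq_dist:
  fixes P Q :: "'a::real_inner"
  shows "(Q - P) \<bullet> (Q - P) = (dist P Q)\<^sup>2"
  by (metis dist_commute dist_norm power2_norm_eq_inner)

text \<open>Along the line the squared distance from \<open>I\<close> is a quadratic polynomial in
  the parameter. The circle meets the line in \<open>p\<close> alone exactly when \<open>p\<close>
  is a double root at level \<open>r\<close>, that is, when \<open>p\<close> is the foot of the
  perpendicular from \<open>I\<close>.\<close>

lemma tangent_to_side_iff:
  assumes "P \<noteq> Q"
  shows "tangent_to_side I r P Q \<longleftrightarrow>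
    (\<exists>p\<in>closed_segment P Q. dist I p = r \<and> (I - p) \<bullet> (Q - P) = 0)"
proof -
  let ?u = "Q - P"
  have uu: "?u \<bullet> ?u \<noteq> 0" using assms by simp
  have dist_shift: "(dist I (p + s *\<^sub>R ?u))\<^sup>2 = (dist I p)\<^sup>2 - s * (2 * ((I - p) \<bullet> ?u) - s * (?u \<bullet> ?u))"
    for p s
    unfolding dist_norm power2_norm_eq_inner
    by (simp add: inner_diff_left inner_diff_right inner_add_left inner_add_right inner_commute
        algebra_simps)
  \<comment> \<open>The base point of the parametrization moves from \<open>P\<close> to
    \<open>p\<close>, so that \<open>dist_shift\<close> compares points of the line with
    \<open>p\<close>.\<close>
  have line: "q \<in> affine hull {P, Q} \<longleftrightarrow> (\<exists>s. q = p + s *\<^sub>R ?u)" if p_in: "p \<in> affine hull {P, Q}" for p q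
  proof -
    obtain s0 where p: "p = P + s0 *\<^sub>R ?u"
      using p_in unfolding affine_hull_2_alt by blast
    have "q = P + s *\<^sub>R ?u \<longleftrightarrow> q = p + (s - s0) *\<^sub>R ?u" for s
      by (auto simp: p scaleR_left_diff_distrib)
    moreover have "q = p + s *\<^sub>R ?u \<longleftrightarrow> q = P + (s + s0) *\<^sub>R ?u" for s
      by (auto simp: p scaleR_left_distrib add_ac)
    ultimately show ?thesis
      unfolding affine_hull_2_alt by blast
  qed
  have "sphere I r \<inter> affine hull {P, Q} = {p} \<longleftrightarrow> dist I p = r \<and> (I - p) \<bullet> ?u = 0"
    if "p \<in> closed_segment P Q" for p
  proof -
    have p: "p \<in> affine hull {P, Q}"
      using that convex_hull_subset_affine_hull segment_convex_hull by blast
    show ?thesis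
    proof
      assume eq: "sphere I r \<inter> affine hull {P, Q} = {p}"
      then have r: "dist I p = r" by auto
      \<comment> \<open>the reflection of \<open>p\<close> in the foot of the perpendicular also lies on the circle\<close>
      define s where "s = 2 * ((I - p) \<bullet> ?u) / (?u \<bullet> ?u)"
      have "(dist I (p + s *\<^sub>R ?u))\<^sup>2 = (dist I p)\<^sup>2"
        unfolding dist_shift using uu by (simp add: s_def)
      then have "dist I (p + s *\<^sub>R ?u) = r"
        using r by (metis power2_eq_iff_nonneg zero_le_dist)
      then have "p + s *\<^sub>R ?u \<in> sphere I r \<inter> affine hull {P, Q}"
        using line[OF p] by auto
      then have "s = 0" using eq assms by auto
      then show "dist I p = r \<and> (I - p) \<bullet> ?u = 0" using r uu by (simp add: s_def)
    next
      assume foot: "dist I p = r \<and> (I - p) \<bullet> ?u = 0"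
      have "q = p" if q: "q \<in> sphere I r" "q \<in> affine hull {P, Q}" for q
      proof -
        obtain s where s: "q = p + s *\<^sub>R ?u" using line[OF p] q(2) by blast
        have "(dist I q)\<^sup>2 = (dist I p)\<^sup>2 + s * s * (?u \<bullet> ?u)"
          unfolding s dist_shift using foot by simp
        then show ?thesis using q(1) foot uu s by simp
      qed
      then show "sphere I r \<inter> affine hull {P, Q} = {p}" using foot p by auto
    qed
  qed
  then show ?thesis unfolding tangent_to_side_def by blast
qed

text \<open>Pythagoras in the right triangle \<open>I p P\<close>, and projection of
  \<open>I - P\<close> onto the side. As \<open>p\<close> lies on the segment, \<open>p - P\<close>
  points towards \<open>Q\<close>, which fixes the sign in the second equation.\<close>

lemma foot_in_segment:
  fixes I P Q p :: "'a::real_inner"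
  assumes "p \<in> closed_segment P Q" and "(I - p) \<bullet> (Q - P) = 0"
  shows "(dist I P)\<^sup>2 = (dist I p)\<^sup>2 + (dist P p)\<^sup>2"
    and "(I - P) \<bullet> (Q - P) = dist P Q * dist P p"
proof -
  obtain s where s: "0 \<le> s" "p = P + s *\<^sub>R (Q - P)"
    using assms(1) by (auto simp: in_segment algebra_simps)
  have orth: "(I - p) \<bullet> (p - P) = 0" using assms(2) s(2) by simp
  have split: "I - P = (I - p) + (p - P)" by simp
  have "(norm (I - P))\<^sup>2 = (norm (I - p))\<^sup>2 + (norm (p - P))\<^sup>2"
    by (subst split, subst norm_add_Pythagorean) (use orth in \<open>auto simp: orthogonal_def\<close>)
  then show "(dist I P)\<^sup>2 = (dist I p)\<^sup>2 + (dist P p)\<^sup>2"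
    by (simp add: dist_norm norm_minus_commute)
  have "(I - P) \<bullet> (Q - P) = (p - P) \<bullet> (Q - P)"
    by (subst split, subst inner_add_left) (simp add: assms(2))
  also have "\<dots> = s * (dist P Q)\<^sup>2"
    by (simp add: s(2) inner_diff_self_eq_dist)
  also have "\<dots> = dist P Q * dist P p"
    using s by (simp add: dist_norm norm_minus_commute power2_eq_square)
  finally show "(I - P) \<bullet> (Q - P) = dist P Q * dist P p" .
qed

text \<open>The contact point is the point of \<open>PQ\<close> at distance \<open>t\<close> from
  \<open>P\<close>: the scalar product makes it the foot from \<open>I\<close>, the bounds on
  \<open>t\<close> keep it on the side, and Pythagoras gives its distance \<open>r\<close> from
  \<open>I\<close>.\<close>

lemma tangent_to_sideI:
  assumes "P \<noteq> Q" and "(I - P) \<bullet> (Q - P) = dist P Q * t" and "(dist I P)\<^sup>2 = r\<^sup>2 + t\<^sup>2"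
    and "0 \<le> t" "t \<le> dist P Q" "0 \<le> r"
  shows "tangent_to_side I r P Q"
proof -
  let ?u = "Q - P"
  define s where "s = t / dist P Q"
  define p where "p = P + s *\<^sub>R ?u"
  have d: "dist P Q > 0" using assms(1) by simp
  have uu: "?u \<bullet> ?u = (dist P Q)\<^sup>2"
    by (rule inner_diff_self_eq_dist)
  have sd: "s * dist P Q = t" using d by (simp add: s_def)
  have "0 \<le> s" "s \<le> 1" using assms d by (auto simp: s_def)
  then have p: "p \<in> closed_segment P Q"
    by (auto simp: in_segment p_def algebra_simps)
  have orth: "(I - p) \<bullet> ?u = 0"
  proof -
    have "(I - p) \<bullet> ?u = (I - P) \<bullet> ?u - s * (?u \<bullet> ?u)"
      by (simp add: p_def inner_diff_left inner_add_left)
    then show ?thesis by (simp add: assms(2) uu power2_eq_square flip: sd)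
  qed
  have "dist P p = t"
    using sd \<open>0 \<le> s\<close> by (simp add: p_def dist_norm norm_minus_commute)
  then have "(dist I p)\<^sup>2 = r\<^sup>2"
    using foot_in_segment(1)[OF p orth] assms(3) by simp
  then have "dist I p = r" using assms(6) by simp
  then show ?thesis
    using p orth by (subst tangent_to_side_iff[OF assms(1)]) auto
qed

section \<open>Consequences of non-collinearity\<close>

lemma not_collinear_imp_dist_less:
  fixes A B C :: "'a::euclidean_space"
  assumes "\<not> collinear {A, B, C}"
  shows "dist B C < dist A B + dist A C"
proof -
  have "\<not> between (B, C) A"
    using assms between_imp_collinear by (metis insert_commute)
  then have "dist B C \<noteq> dist B A + dist A C"
    by (simp add: between)
  then show ?thesis
    using dist_triangle[of B C A] by (simp add: dist_commute)
qed

text \<open>A nonzero \<open>w\<close> would force the determinant of \<open>u\<close> and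
  \<open>v\<close> to vanish, hence equality in Cauchy-Schwarz. This yields uniqueness of the
  incenter.\<close>

lemma eq_zero_if_orthogonal_noncollinear:
  fixes w u v :: "real^2"
  assumes "w \<bullet> u = 0" "w \<bullet> v = 0" "\<not> collinear {0, u, v}"
  shows "w = 0"
proof (rule ccontr)
  assume "w \<noteq> 0"
  then have w: "w$1 \<noteq> 0 \<or> w$2 \<noteq> 0" by (auto simp: vec_eq_iff forall_2)
  have e: "w$1 * u$1 + w$2 * u$2 = 0" "w$1 * v$1 + w$2 * v$2 = 0"
    using assms by (auto simp: inner_vec_def sum_2)
  have "w$1 * (u$1 * v$2 - u$2 * v$1) = 0" "w$2 * (u$1 * v$2 - u$2 * v$1) = 0"
    using e by algebra+
  then have det: "u$1 * v$2 - u$2 * v$1 = 0" using w by auto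
  \<comment> \<open>Lagrange's identity: the two sides differ by the square of the
    determinant.\<close>
  have "(u \<bullet> v)\<^sup>2 = (u \<bullet> u) * (v \<bullet> v)"
    unfolding inner_vec_def sum_2 inner_real_def using det by algebra
  then have "\<bar>u \<bullet> v\<bar>\<^sup>2 = (norm u * norm v)\<^sup>2"
    by (simp add: power_mult_distrib power2_norm_eq_inner)
  then have "\<bar>u \<bullet> v\<bar> = norm u * norm v"
    by (subst (asm) power2_eq_iff_nonneg) auto
  then show False using assms(3) norm_cauchy_schwarz_equal by blast
qed

section \<open>The incenter and inradius in terms of the side lengths\<close>

definition tangent_length :: "'a::metric_space \<Rightarrow> 'a \<Rightarrow> 'a \<Rightarrow> real" where
  "tangent_length A B C = (dist A B + dist A C - dist B C) / 2"

text \<open>The incenter in barycentric coordinates, an explicit witness for the description in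
  \<open>incenter\<close>.\<close>

definition weighted_center :: "'a::euclidean_space \<Rightarrow> 'a \<Rightarrow> 'a \<Rightarrow> 'a" where
  "weighted_center A B C =
     (dist B C *\<^sub>R A + dist C A *\<^sub>R B + dist A B *\<^sub>R C) /\<^sub>R (dist B C + dist C A + dist A B)"

text \<open>Heron's formula \<open>(s - a)(s - b)(s - c) / s\<close> for the squared inradius, with
  the perimeter \<open>2 * s\<close> as denominator.\<close>

definition inradius_sq :: "'a::metric_space \<Rightarrow> 'a \<Rightarrow> 'a \<Rightarrow> real" where
  "inradius_sq A B C = 2 * tangent_length A B C * tangent_length B C A * tangent_length C A B
     / (dist B C + dist C A + dist A B)"

lemma tangent_length_swap: "tangent_length A C B = tangent_length A B C"
  by (simp add: tangent_length_def dist_commute)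

lemma weighted_center_perm:
  "weighted_center B C A = weighted_center A B C"
  "weighted_center A C B = weighted_center A B C"
  by (simp_all add: weighted_center_def dist_commute add_ac)

lemma inradius_sq_perm: "inradius_sq B C A = inradius_sq A B C"
  by (simp add: inradius_sq_def add_ac mult_ac)

text \<open>With \<open>A\<close> as origin, the law of cosines turns both claims into rational
  identities in the side lengths. They supply the scalar product and squared distance required by
  \<open>tangent_to_sideI\<close> and \<open>dist_extension_endpoint\<close>.\<close>

lemma weighted_center_eqs:
  fixes A B C :: "'a::euclidean_space"
  assumes "A \<noteq> B"
  shows "(weighted_center A B C - A) \<bullet> (B - A) = dist A B * tangent_length A B C"
    and "(dist (weighted_center A B C) A)\<^sup>2 = inradius_sq A B C + (tangent_length A B C)\<^sup>2"
proof -
  define a b c where "a = dist B C" and "b = dist C A" and "c = dist A B"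
  let ?u = "B - A" and ?v = "C - A" and ?p = "a + b + c"
  have p: "?p > 0" using assms by (simp add: a_def b_def c_def add_nonneg_pos)
  have uu: "?u \<bullet> ?u = c\<^sup>2"
    by (simp add: c_def inner_diff_self_eq_dist)
  have vv: "?v \<bullet> ?v = b\<^sup>2"
    by (simp add: b_def inner_diff_self_eq_dist dist_commute)
  \<comment> \<open>Law of cosines at \<open>A\<close>, from \<open>B - C = ?u - ?v\<close>.\<close>
  have "a\<^sup>2 = (?u - ?v) \<bullet> (?u - ?v)"
    by (simp add: a_def dist_norm power2_norm_eq_inner)
  also have "\<dots> = ?u \<bullet> ?u + ?v \<bullet> ?v - 2 * (?u \<bullet> ?v)"
    by (simp only: inner_diff_left[of ?u ?v] inner_diff_right[of _ ?u ?v] inner_commute[of ?v ?u])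
  finally have uv: "?u \<bullet> ?v = (b\<^sup>2 + c\<^sup>2 - a\<^sup>2) / 2" using uu vv by simp
  have t: "tangent_length A B C = (b + c - a) / 2" "tangent_length B C A = (a + c - b) / 2"
    "tangent_length C A B = (a + b - c) / 2"
    by (simp_all add: tangent_length_def a_def b_def c_def dist_commute)
  have "?p *\<^sub>R (weighted_center A B C - A) = b *\<^sub>R ?u + c *\<^sub>R ?v"
    using p by (simp add: weighted_center_def scaleR_diff_right flip: a_def b_def c_def)
      (simp add: algebra_simps)
  then have w: "weighted_center A B C - A = (b *\<^sub>R ?u + c *\<^sub>R ?v) /\<^sub>R ?p"
    using p by (metis less_irrefl divideR_right)
  have "(weighted_center A B C - A) \<bullet> ?u = (b * c\<^sup>2 + c * ((b\<^sup>2 + c\<^sup>2 - a\<^sup>2) / 2)) / ?p"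
    unfolding w by (simp add: inner_add_left uu uv inner_commute[of ?v ?u] divide_simps)
  also have "\<dots> = c * ((b + c - a) / 2)"
    using p by (simp add: field_simps power2_eq_square)
  finally show "(weighted_center A B C - A) \<bullet> (B - A) = dist A B * tangent_length A B C"
    by (simp add: t c_def)
  have "(dist (weighted_center A B C) A)\<^sup>2
      = (b\<^sup>2 * c\<^sup>2 + c\<^sup>2 * b\<^sup>2 + 2 * b * c * ((b\<^sup>2 + c\<^sup>2 - a\<^sup>2) / 2)) / ?p\<^sup>2"
    unfolding dist_norm power2_norm_eq_inner w
    by (simp add: inner_add_left inner_add_right uu vv uv inner_commute[of ?v ?u] power2_eq_square
        divide_simps)
      (simp add: algebra_simps)
  also have "\<dots> = 2 * ((b + c - a) / 2) * ((a + c - b) / 2) * ((a + b - c) / 2) / ?p + ((b + c - a) / 2)\<^sup>2"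
    using p by (simp add: divide_simps) algebra
  finally show "(dist (weighted_center A B C) A)\<^sup>2 = inradius_sq A B C + (tangent_length A B C)\<^sup>2"
    by (simp add: inradius_sq_def t flip: a_def b_def c_def)
qed

text \<open>Existence of the incircle: the strict triangle inequalities make the tangent lengths
  positive and at most the adjacent sides, and rotating the vertices carries the computation for
  \<open>AB\<close> over to the other sides.\<close>

lemma inscribed_circle_weighted_center:
  assumes "\<not> collinear {A, B, C}"
  shows "inradius_sq A B C > 0"
    and "inscribed_circle (weighted_center A B C) (sqrt (inradius_sq A B C)) A B C"
proof -
  have ne: "A \<noteq> B" "B \<noteq> C" "C \<noteq> A" using assms by (auto simp: insert_commute)
  have perm: "{B, C, A} = {A, B, C}" "{C, A, B} = {A, B, C}" by auto
  have less: "dist B C < dist A B + dist C A" "dist C A < dist B C + dist A B"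
    "dist A B < dist C A + dist B C"
    using not_collinear_imp_dist_less[of A B C] not_collinear_imp_dist_less[of B C A]
      not_collinear_imp_dist_less[of C A B] assms
    by (simp_all add: perm dist_commute)
  have t: "tangent_length A B C > 0" "tangent_length B C A > 0" "tangent_length C A B > 0"
    "tangent_length A B C \<le> dist A B" "tangent_length B C A \<le> dist B C"
    "tangent_length C A B \<le> dist C A"
    using less by (simp_all add: tangent_length_def dist_commute)
  show pos: "inradius_sq A B C > 0"
    unfolding inradius_sq_def using t less by (intro divide_pos_pos mult_pos_pos) auto
  let ?I = "weighted_center A B C" and ?r = "sqrt (inradius_sq A B C)"
  have perms: "weighted_center B C A = ?I" "weighted_center C A B = ?I"
    "inradius_sq B C A = inradius_sq A B C" "inradius_sq C A B = inradius_sq A B C"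
    by (metis weighted_center_perm(1) inradius_sq_perm)+
  have "tangent_to_side ?I ?r A B"
    using weighted_center_eqs[OF ne(1), of C] t pos ne by (intro tangent_to_sideI) auto
  moreover have "tangent_to_side ?I ?r B C"
    using weighted_center_eqs[OF ne(2), of A] t pos ne by (intro tangent_to_sideI) (auto simp: perms)
  moreover have "tangent_to_side ?I ?r C A"
    using weighted_center_eqs[OF ne(3), of B] t pos ne by (intro tangent_to_sideI) (auto simp: perms)
  ultimately show "inscribed_circle ?I ?r A B C"
    using pos by (simp add: inscribed_circle_def)
qed

text \<open>The right-hand sides depend only on the triangle, so all inscribed circles share these
  scalar products; this is the uniqueness half.\<close>

lemma inscribed_circle_inner:
  assumes "inscribed_circle I r A B C" "A \<noteq> B" "B \<noteq> C" "C \<noteq> A"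
  shows "(I - A) \<bullet> (B - A) = dist A B * tangent_length A B C"
    and "(I - A) \<bullet> (C - A) = dist A C * tangent_length A B C"
proof -
  obtain p q w where
    p: "p \<in> closed_segment B C" "dist I p = r" "(I - p) \<bullet> (C - B) = 0" and
    q: "q \<in> closed_segment C A" "dist I q = r" "(I - q) \<bullet> (A - C) = 0" and
    w: "w \<in> closed_segment A B" "dist I w = r" "(I - w) \<bullet> (B - A) = 0"
    using assms by (auto simp: inscribed_circle_def tangent_to_side_iff)
  have rev: "p \<in> closed_segment C B" "(I - p) \<bullet> (B - C) = 0"
    "q \<in> closed_segment A C" "(I - q) \<bullet> (C - A) = 0"
    "w \<in> closed_segment B A" "(I - w) \<bullet> (A - B) = 0"
    using p q w by (auto simp: closed_segment_commute inner_diff_right)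
  \<comment> \<open>The two tangents from a vertex are equal: their right triangles share the
    hypotenuse and have the leg \<open>r\<close>.\<close>
  have "(dist A q)\<^sup>2 = (dist A w)\<^sup>2" "(dist B p)\<^sup>2 = (dist B w)\<^sup>2" "(dist C p)\<^sup>2 = (dist C q)\<^sup>2"
    using foot_in_segment(1)[OF p(1,3)] foot_in_segment(1)[OF q(1,3)] foot_in_segment(1)[OF w(1,3)]
      foot_in_segment(1)[OF rev(1,2)] foot_in_segment(1)[OF rev(3,4)] foot_in_segment(1)[OF rev(5,6)]
      p(2) q(2) w(2) by simp_all
  then have eq: "dist A q = dist A w" "dist B p = dist B w" "dist C p = dist C q"
    by (simp_all add: power2_eq_iff_nonneg)
  \<comment> \<open>Contact points on the sides themselves split each side into two tangents; this
    linear system determines the tangent lengths.\<close>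
  have "dist B C = dist B p + dist C p" "dist C A = dist C q + dist A q" "dist A B = dist A w + dist B w"
    using p(1) q(1) w(1) by (simp_all add: between dist_commute flip: between_mem_segment)
  then have t: "dist A w = tangent_length A B C" "dist A q = tangent_length A B C"
    using eq by (simp_all add: tangent_length_def dist_commute)
  show "(I - A) \<bullet> (B - A) = dist A B * tangent_length A B C"
    using foot_in_segment(2)[OF w(1,3)] t by simp
  show "(I - A) \<bullet> (C - A) = dist A C * tangent_length A B C"
    using foot_in_segment(2)[OF rev(3,4)] t by simp
qed

lemma incenter_eq_weighted_center:
  assumes "\<not> collinear {A, B, C}"
  shows "incenter A B C = weighted_center A B C"
  unfolding incenter_def
proof (rule the_equality)
  let ?J = "weighted_center A B C"
  show ex: "\<exists>r. inscribed_circle ?J r A B C"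
    using inscribed_circle_weighted_center(2)[OF assms] by blast
  fix I assume "\<exists>r. inscribed_circle I r A B C"
  then obtain r r' where I: "inscribed_circle I r A B C" "inscribed_circle ?J r' A B C"
    using ex by blast
  have ne: "A \<noteq> B" "B \<noteq> C" "C \<noteq> A" using assms by (auto simp: insert_commute)
  have "\<not> collinear {B, A, C}" using assms by (simp add: insert_commute)
  then have "\<not> collinear {0, B - A, C - A}" by (subst (asm) collinear_3) auto
  moreover have "(I - A - (?J - A)) \<bullet> (B - A) = 0" "(I - A - (?J - A)) \<bullet> (C - A) = 0"
    using inscribed_circle_inner[OF I(1) ne] inscribed_circle_inner[OF I(2) ne]
    by (simp_all only: inner_diff_left[of "I - A" "?J - A"])
  ultimately have "I - A - (?J - A) = 0"
    using eq_zero_if_orthogonal_noncollinear by blast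
  then show "I = ?J" by simp
qed

section \<open>Distances from the incenter to the endpoints\<close>

lemma dist_extension_endpoint:
  assumes "U \<noteq> V" and "(I - V) \<bullet> (U - V) = dist V U * t"
    and "(dist I V)\<^sup>2 = k + t\<^sup>2"
  shows "(dist I (extension_endpoint U V d))\<^sup>2 = k + (t + d)\<^sup>2"
proof -
  define e where "e = (V - U) /\<^sub>R norm (V - U)"
  have "norm e = 1" using assms(1) by (simp add: e_def)
  then have ee: "e \<bullet> e = 1" by (simp flip: power2_norm_eq_inner)
  \<comment> \<open>The outward direction \<open>e\<close> is opposite to the side as seen from
    \<open>V\<close>, hence the sign of \<open>- t\<close>, which makes the expansion below complete
    to \<open>(t + d)\<close> squared.\<close>
  have "(I - V) \<bullet> (V - U) = - ((I - V) \<bullet> (U - V))"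
    by (simp add: inner_diff_right)
  then have Ie: "(I - V) \<bullet> e = - t"
    using assms(1,2) by (simp add: e_def dist_norm)
  have "(dist I (extension_endpoint U V d))\<^sup>2 = ((I - V) - d *\<^sub>R e) \<bullet> ((I - V) - d *\<^sub>R e)"
    by (simp add: extension_endpoint_def dist_norm power2_norm_eq_inner e_def algebra_simps)
  also have "\<dots> = (I - V) \<bullet> (I - V) - 2 * d * ((I - V) \<bullet> e) + d\<^sup>2 * (e \<bullet> e)"
    by (simp only: inner_diff_left[of "I - V" "d *\<^sub>R e"] inner_diff_right[of _ "I - V" "d *\<^sub>R e"]
        inner_commute[of e "I - V"] inner_scaleR_left inner_scaleR_right)
      algebra
  also have "\<dots> = k + (t + d)\<^sup>2"
    using assms(3) unfolding Ie ee dist_norm power2_norm_eq_inner by algebra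
  finally show ?thesis .
qed

lemma dist_incenter_extension_endpoint:
  assumes "\<not> collinear {A, B, C}"
  shows "(dist (incenter A B C) (extension_endpoint B A d))\<^sup>2
      = inradius_sq A B C + (tangent_length A B C + d)\<^sup>2"
    and "(dist (incenter A B C) (extension_endpoint C A d))\<^sup>2
      = inradius_sq A B C + (tangent_length A B C + d)\<^sup>2"
proof -
  have ne: "A \<noteq> B" "B \<noteq> C" "C \<noteq> A" using assms by (auto simp: insert_commute)
  show "(dist (incenter A B C) (extension_endpoint B A d))\<^sup>2
      = inradius_sq A B C + (tangent_length A B C + d)\<^sup>2"
    using weighted_center_eqs[OF ne(1), of C] ne
    by (intro dist_extension_endpoint) (auto simp: incenter_eq_weighted_center[OF assms])
  show "(dist (incenter A B C) (extension_endpoint C A d))\<^sup>2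
      = inradius_sq A B C + (tangent_length A B C + d)\<^sup>2"
    \<comment> \<open>Only the scalar product needs \<open>B\<close> and \<open>C\<close> exchanged;
      the distance from the incenter to \<open>A\<close> is common to both sides.\<close>
    using weighted_center_eqs(1)[of A C B] weighted_center_eqs(2)[OF ne(1), of C] ne
    by (intro dist_extension_endpoint)
      (auto simp: incenter_eq_weighted_center[OF assms] weighted_center_perm(2) tangent_length_swap[of A C B])
qed

theorem theorem1:
  fixes A B C :: "real^2" and x lam :: "real^2 \<Rightarrow> real"
  assumes "\<not> collinear {A, B, C}"
    and "lam A = dist B C" and "lam B = dist C A" and "lam C = dist A B"
    and "\<forall>V\<in>{A, B, C}. x V \<ge> 0"
  shows "(\<exists>r>0. \<forall>V\<in>{A, B, C}. \<forall>U\<in>{A, B, C} - {V}.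
            extension_endpoint U V (x V) \<in> sphere (incenter A B C) r)
         \<longleftrightarrow> (\<forall>U\<in>{A, B, C}. \<forall>V\<in>{A, B, C}. x U - x V = lam U - lam V)"
proof -
  let ?I = "incenter A B C" and ?k = "inradius_sq A B C"
  define s where "s = (dist B C + dist C A + dist A B) / 2"
  have ne: "A \<noteq> B" "B \<noteq> C" "C \<noteq> A" using assms(1) by (auto simp: insert_commute)
  have nc: "\<not> collinear {B, C, A}" "\<not> collinear {C, A, B}"
    using assms(1) by (simp_all add: insert_commute)
  have k: "?k > 0" using inscribed_circle_weighted_center(1)[OF assms(1)] .
  have perms: "incenter B C A = ?I" "incenter C A B = ?I"
    "inradius_sq B C A = ?k" "inradius_sq C A B = ?k"
    using assms(1) nc by (metis incenter_eq_weighted_center weighted_center_perm(1) inradius_sq_perm)+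
  have t: "tangent_length A B C = s - lam A" "tangent_length B C A = s - lam B"
    "tangent_length C A B = s - lam C"
    by (simp_all add: tangent_length_def s_def assms dist_commute field_simps)
  \<comment> \<open>The three rotations of the triangle, with two sides through the leading vertex
    each, cover all six endpoints.\<close>
  have endpoint: "(dist ?I (extension_endpoint U V (x V)))\<^sup>2 = ?k + (s - lam V + x V)\<^sup>2"
    if "V \<in> {A, B, C}" "U \<in> {A, B, C} - {V}" for U V
    using that dist_incenter_extension_endpoint[OF assms(1)] dist_incenter_extension_endpoint[OF nc(1)]
      dist_incenter_extension_endpoint[OF nc(2)] by (auto simp: perms t)
  \<comment> \<open>Nonnegativity allows equal squares to be cancelled in the forward
    direction.\<close>
  have nonneg: "s - lam V + x V \<ge> 0" if "V \<in> {A, B, C}" for V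
  proof -
    have "lam V \<le> s"
      using that dist_triangle[of B C A] dist_triangle[of C A B] dist_triangle[of A B C]
      by (auto simp: s_def assms dist_commute)
    then show ?thesis using assms(5) that by auto
  qed
  show ?thesis
  proof
    assume "\<exists>r>0. \<forall>V\<in>{A, B, C}. \<forall>U\<in>{A, B, C} - {V}.
      extension_endpoint U V (x V) \<in> sphere ?I r"
    then obtain r where r: "\<And>U V. V \<in> {A, B, C} \<Longrightarrow> U \<in> {A, B, C} - {V} \<Longrightarrow>
      dist ?I (extension_endpoint U V (x V)) = r"
      by auto
    have sq: "(s - lam V + x V)\<^sup>2 = r\<^sup>2 - ?k" if V: "V \<in> {A, B, C}" for V
    proof -
      obtain U where "U \<in> {A, B, C} - {V}" using V ne by blast
      then show ?thesis using endpoint[OF V] r[OF V] by fastforce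
    qed
    have "s - lam U + x U = s - lam V + x V" if "U \<in> {A, B, C}" "V \<in> {A, B, C}" for U V
      using sq[OF that(1)] sq[OF that(2)] nonneg[OF that(1)] nonneg[OF that(2)]
      by (metis power2_eq_iff_nonneg)
    then show "\<forall>U\<in>{A, B, C}. \<forall>V\<in>{A, B, C}. x U - x V = lam U - lam V"
      by (smt (verit))
  next
    assume eq: "\<forall>U\<in>{A, B, C}. \<forall>V\<in>{A, B, C}. x U - x V = lam U - lam V"
    \<comment> \<open>The common distance, read off at \<open>A\<close>; it is positive because the
      squared inradius is.\<close>
    define R where "R = sqrt (?k + (s - lam A + x A)\<^sup>2)"
    have "extension_endpoint U V (x V) \<in> sphere ?I R"
      if "V \<in> {A, B, C}" "U \<in> {A, B, C} - {V}" for U V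
    proof -
      have "x V - x A = lam V - lam A" using eq that(1) by blast
      then have "s - lam V + x V = s - lam A + x A" by simp
      then have "R = sqrt ((dist ?I (extension_endpoint U V (x V)))\<^sup>2)"
        unfolding R_def endpoint[OF that] by (simp only:)
      then show ?thesis by simp
    qed
    moreover have "R > 0" using k by (simp add: R_def add_pos_nonneg)
    ultimately show "\<exists>r>0. \<forall>V\<in>{A, B, C}. \<forall>U\<in>{A, B, C} - {V}.
      extension_endpoint U V (x V) \<in> sphere ?I r"
      by blast
  qed
qed

end
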